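(* Let $T_1,T_2,T_3,T_4$ be the sets of prime constellations greater than $5$ of the forms $\{p,p+2\}$, $\{p,p+2,p+6\}$, $\{p,p+2,p+6,p+8\}$, $\{p,p+2,p+6,p+8,p+12\}$ respectively (all listed numbers prime, $p>5$). Then every element of every member of $T_1,T_2,T_3,T_4$ lies in some principal Eratosthenes ray $r_{p_0}$, $p_0\in\overline{C}$. Moreover, at most one element of each pair in $T_1$, at most two elements of each triple in $T_2$ and of each quadruple in $T_3$, and at most three elements of each quintuple in $T_4$ fail to be the origin (first element) of a principal ray; equivalently, the remaining elements belong to $P_1=\{\pi^{-1}(p_0): p_0\in\overline{C}\}$.
   Context: $P$ is the set of primes, $p_1=2<p_2=3<\dots$ its elements, $\pi(p_n)=n$ and $\pi^{-1}(n)=p_n$. $\overline{C}=\mathbb{N}\setminus P=\{1,4,6,8,9,\ldots\}$. For $p_0\in\mathbb{N}$ the Eratosthenes ray is $r_{p_0}=\{p_{k+1}:k\ge0\}$ with $p_{k+1}=\pi^{-1}(p_k)$; rays with base in $\overline{C}$ are principal, and the origin of the principal ray $r_{p_0}$ is its first element $\pi^{-1}(p_0)$. Thus a prime $q$ is an origin of a principal ray iff $\pi(q)\in\overline{C}$. *)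

theory Defs
  imports "HOL-Library.Infinite_Set" "HOL-Computational_Algebra.Primes"
begin

text \<open>
  The paper's natural numbers start at 1. Since \<^const>\<open>enumerate\<close> counts from 0, the
  \<open>n\<close>-th prime is shifted by one; \<open>nth_prime\<close> is only meaningful for positive arguments.
\<close>

definition nth_prime :: "nat \<Rightarrow> nat" where
  "nth_prime n = enumerate {p. prime p} (n - 1)"

definition prime_pi :: "nat \<Rightarrow> nat" where
  "prime_pi x = card {p. prime p \<and> p \<le> x}"

lemma prime_pi_nth_prime:
  assumes "n \<ge> 1"
  shows "prime_pi (nth_prime n) = n"
proof -
  let ?P = "{p::nat. prime p}"
  have inf: "infinite ?P" by (rule primes_infinite)
  have "{p. prime p \<and> p \<le> enumerate ?P (n - 1)} = enumerate ?P ` {..n - 1}" (is "?L = ?R")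
  proof
    show "?L \<subseteq> ?R"
    proof
      fix p assume p: "p \<in> ?L"
      then obtain k where "p = enumerate ?P k"
        using enumerate_Ex[OF inf, of p] by auto
      with p inf show "p \<in> ?R" by auto
    qed
    show "?R \<subseteq> ?L"
      using enumerate_in_set[OF inf] inf by auto
  qed
  moreover have "card (enumerate ?P ` {..n - 1}) = n"
    using assms card_image[OF inj_on_subset[OF inj_enumerate[OF inf] subset_UNIV], of "{..n - 1}"]
    by simp
  ultimately show ?thesis by (simp add: prime_pi_def nth_prime_def)
qed

definition nonprimes :: "nat set" where
  "nonprimes = {n. n \<ge> 1 \<and> \<not> prime n}"

text \<open>\<open>ray_seq p0 k\<close> is \<open>p_k\<close>; the base \<open>p_0\<close> itself is not an element of the ray.\<close>

definition ray_seq :: "nat \<Rightarrow> nat \<Rightarrow> nat" where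
  "ray_seq p0 k = (nth_prime ^^ k) p0"

definition eratosthenes_ray :: "nat \<Rightarrow> nat set" where
  "eratosthenes_ray p0 = {ray_seq p0 (k + 1) | k. k \<ge> 0}"

definition ray_origin :: "nat \<Rightarrow> nat" where
  "ray_origin p0 = ray_seq p0 1"

definition principal_origin :: "nat \<Rightarrow> bool" where
  "principal_origin q \<longleftrightarrow> (\<exists>p0\<in>nonprimes. q = ray_origin p0)"

definition P1 :: "nat set" where
  "P1 = {nth_prime p0 | p0. p0 \<in> nonprimes}"

definition T1 :: "nat set set" where
  "T1 = {{p, p + 2} | p. p > 5 \<and> prime p \<and> prime (p + 2)}"

definition T2 :: "nat set set" where
  "T2 = {{p, p + 2, p + 6} | p. p > 5 \<and> prime p \<and> prime (p + 2) \<and> prime (p + 6)}"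

definition T3 :: "nat set set" where
  "T3 = {{p, p + 2, p + 6, p + 8} | p.
     p > 5 \<and> prime p \<and> prime (p + 2) \<and> prime (p + 6) \<and> prime (p + 8)}"

definition T4 :: "nat set set" where
  "T4 = {{p, p + 2, p + 6, p + 8, p + 12} | p.
     p > 5 \<and> prime p \<and> prime (p + 2) \<and> prime (p + 6) \<and> prime (p + 8) \<and> prime (p + 12)}"

end

theory Submission
  imports Defs
begin

text \<open>
  A prime \<open>q\<close> fails to be an origin iff its index \<open>prime_pi q\<close> is itself prime. Since
  \<open>prime_pi q < q\<close>, iterating \<^const>\<open>prime_pi\<close> from \<open>q\<close> reaches a nonprime, so \<open>q\<close> lies in a
  principal ray. Twin primes have consecutive indices, and these cannot both be prime beyond
  \<open>2, 3\<close>; hence every twin pair above \<open>5\<close> contains an origin. The cardinality bounds follow by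
  counting the disjoint twin pairs \<open>{p, p + 2}\<close> and \<open>{p + 6, p + 8}\<close>.
\<close>

text \<open>Every prime occurs in the enumeration, so the left inverse property of
  \<open>prime_pi\<close> becomes two-sided on primes.\<close>

lemma nth_prime_prime_pi:
  assumes "prime q"
  shows "nth_prime (prime_pi q) = q"
proof -
  obtain k where "q = enumerate {p::nat. prime p} k"
    using enumerate_Ex[OF primes_infinite, of q] assms by auto
  \<comment> \<open>\<open>Suc k\<close> undoes the shift \<open>n - 1\<close> in
    \<open>nth_prime\<close> and makes the index positive.\<close>
  then have "q = nth_prime (Suc k)" by (simp add: nth_prime_def)
  then show ?thesis using prime_pi_nth_prime[of "Suc k"] by simp
qed

lemma finite_primes_le: "finite {p::nat. prime p \<and> p \<le> x}"
  by (rule finite_subset[of _ "{..x}"]) auto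

lemma prime_pi_mono: "x \<le> y \<Longrightarrow> prime_pi x \<le> prime_pi y"
  unfolding prime_pi_def by (intro card_mono finite_primes_le) auto

lemma prime_pi_pos:
  assumes "prime q"
  shows "prime_pi q \<ge> 1"
proof -
  have "{p. prime p \<and> p \<le> q} \<noteq> {}" using assms by auto
  then show ?thesis
    unfolding prime_pi_def by (simp add: Suc_le_eq card_gt_0_iff finite_primes_le)
qed

text \<open>The primes up to \<open>q\<close> lie in \<open>{2..q}\<close>, which has only
  \<open>q - 1\<close> elements. The strict inequality makes the descent along
  \<open>prime_pi\<close> well-founded.\<close>

lemma prime_pi_less:
  assumes "q \<ge> 1"
  shows "prime_pi q < q"
proof -
  have "prime_pi q \<le> card {2..q}"
    unfolding prime_pi_def by (rule card_mono) (auto dest: prime_ge_2_nat)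
  with assms show ?thesis by simp
qed

lemma prime_pi_5: "prime_pi 5 \<ge> 3"
proof -
  have "card {2, 3, 5::nat} \<le> prime_pi 5"
    unfolding prime_pi_def by (rule card_mono[OF finite_primes_le]) auto
  then show ?thesis by simp
qed

text \<open>The number \<open>p + 1\<close> is even and exceeds 2, so \<open>p + 2\<close> is the
  only new prime counted.\<close>

lemma prime_pi_twin:
  assumes "p > 2" "prime p" "prime (p + 2)"
  shows "prime_pi (p + 2) = Suc (prime_pi p)"
proof -
  have "\<not> prime (p + 1)"
    using prime_odd_nat[of p] prime_odd_nat[of "p + 1"] assms by auto
  then have "{q. prime q \<and> q \<le> p + 2} = insert (p + 2) {q. prime q \<and> q \<le> p}"
    using assms by (auto simp: le_Suc_eq)
  then show ?thesis unfolding prime_pi_def by (simp add: finite_primes_le)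
qed

lemma principal_origin_iff_P1: "principal_origin q \<longleftrightarrow> q \<in> P1"
  by (auto simp: principal_origin_def P1_def ray_origin_def ray_seq_def)

text \<open>The index \<open>prime_pi q\<close> serves as the base of the ray; it is positive, as
  \<open>nonprimes\<close> requires.\<close>

lemma principal_originI:
  assumes "prime q" "\<not> prime (prime_pi q)"
  shows "principal_origin q"
proof -
  have "prime_pi q \<in> nonprimes" using assms prime_pi_pos by (simp add: nonprimes_def)
  then show ?thesis
    unfolding principal_origin_iff_P1 P1_def using nth_prime_prime_pi[OF assms(1), symmetric] by blast
qed

lemma prime_in_principal_ray:
  assumes "prime q"
  shows "\<exists>p0\<in>nonprimes. q \<in> eratosthenes_ray p0"
  using assms
proof (induction q rule: less_induct)
  case (less q)
  show ?case
  proof (cases "prime (prime_pi q)")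
    case True
    moreover have "prime_pi q < q"
      using prime_pi_less prime_ge_1_nat[OF less.prems] by simp
    ultimately obtain p0 k where "p0 \<in> nonprimes" "prime_pi q = ray_seq p0 (k + 1)"
      using less.IH[of "prime_pi q"] by (auto simp: eratosthenes_ray_def)
    \<comment> \<open>Applying \<open>nth_prime\<close> to the index moves one place further along
      the same ray.\<close>
    moreover from this have "q = ray_seq p0 ((k + 1) + 1)"
      using nth_prime_prime_pi[OF less.prems] by (simp add: ray_seq_def)
    ultimately show ?thesis unfolding eratosthenes_ray_def by blast
  next
    case False
    then obtain p0 where "p0 \<in> nonprimes" "q = ray_seq p0 (0 + 1)"
      using principal_originI[OF less.prems] by (auto simp: principal_origin_def ray_origin_def)
    then show ?thesis unfolding eratosthenes_ray_def by blast
  qed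
qed

lemma twin_contains_principal_origin:
  assumes "p > 5" "prime p" "prime (p + 2)"
  shows "principal_origin p \<or> principal_origin (p + 2)"
proof (rule ccontr)
  assume "\<not> ?thesis"
  then have "prime (prime_pi p)" "prime (prime_pi (p + 2))"
    using principal_originI assms by blast+
  moreover have "prime_pi (p + 2) = Suc (prime_pi p)"
    using prime_pi_twin assms by simp
  moreover have "prime_pi p \<ge> 3"
    using prime_pi_5 prime_pi_mono[of 5 p] assms by simp
  \<comment> \<open>Consecutive primes that are both at least 3 would both be odd.\<close>
  ultimately show False
    using prime_odd_nat[of "prime_pi p"] prime_odd_nat[of "prime_pi (p + 2)"] by simp
qed

text \<open>Exhibiting a set \<open>A\<close> of origins confines the non-origins to
  \<open>S - A\<close>.\<close>

lemma card_nonorigins_le: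
  assumes "finite S" "A \<subseteq> S" "\<forall>q\<in>A. principal_origin q"
  shows "card {q\<in>S. \<not> principal_origin q} \<le> card S - card A"
proof -
  have "card {q\<in>S. \<not> principal_origin q} \<le> card (S - A)"
    using assms by (intro card_mono) auto
  with assms show ?thesis by (simp add: card_Diff_subset finite_subset)
qed

lemma card_nonorigins_one_twin:
  assumes "p > 5" "prime p" "prime (p + 2)" "finite S" "{p, p + 2} \<subseteq> S"
  shows "card {q\<in>S. \<not> principal_origin q} \<le> card S - 1"
proof -
  obtain a where "a \<in> {p, p + 2}" "principal_origin a"
    using twin_contains_principal_origin assms(1-3) by blast
  then show ?thesis using card_nonorigins_le[of S "{a}"] assms(4,5) by auto
qed

lemma card_nonorigins_two_twins:
  assumes "p > 5" "prime p" "prime (p + 2)" "prime (p + 6)" "prime (p + 8)"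
    and "finite S" "{p, p + 2, p + 6, p + 8} \<subseteq> S"
  shows "card {q\<in>S. \<not> principal_origin q} \<le> card S - 2"
proof -
  obtain a where a: "a \<in> {p, p + 2}" "principal_origin a"
    using twin_contains_principal_origin assms(1-3) by blast
  \<comment> \<open>The second twin pair starts at \<open>p + 6\<close>.\<close>
  obtain b where b: "b \<in> {p + 6, p + 8}" "principal_origin b"
    using twin_contains_principal_origin[of "p + 6"] assms(1,4,5) by (auto simp: add.commute)
  \<comment> \<open>The two twin pairs are disjoint, so \<open>a\<close> and \<open>b\<close>
    differ.\<close>
  have "card {a, b} = 2" using a b by auto
  then show ?thesis using card_nonorigins_le[of S "{a, b}"] a b assms(6,7) by auto
qed

theorem theorem3:
  shows "(\<forall>S \<in> T1 \<union> T2 \<union> T3 \<union> T4. \<forall>q\<in>S. \<exists>p0\<in>nonprimes. q \<in> eratosthenes_ray p0)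
    \<and> (\<forall>S\<in>T1. card {q\<in>S. \<not> principal_origin q} \<le> 1)
    \<and> (\<forall>S\<in>T2. card {q\<in>S. \<not> principal_origin q} \<le> 2)
    \<and> (\<forall>S\<in>T3. card {q\<in>S. \<not> principal_origin q} \<le> 2)
    \<and> (\<forall>S\<in>T4. card {q\<in>S. \<not> principal_origin q} \<le> 3)
    \<and> (\<forall>S \<in> T1 \<union> T2 \<union> T3 \<union> T4. \<forall>q\<in>S. principal_origin q \<longleftrightarrow> q \<in> P1)"
proof (intro conjI)
  show "\<forall>S \<in> T1 \<union> T2 \<union> T3 \<union> T4. \<forall>q\<in>S. \<exists>p0\<in>nonprimes. q \<in> eratosthenes_ray p0"
    unfolding T1_def T2_def T3_def T4_def by (auto intro!: prime_in_principal_ray)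
  show "\<forall>S\<in>T1. card {q\<in>S. \<not> principal_origin q} \<le> 1"
  proof
    fix S assume "S \<in> T1"
    then obtain p where p: "S = {p, p + 2}" "p > 5" "prime p" "prime (p + 2)"
      unfolding T1_def by blast
    show "card {q\<in>S. \<not> principal_origin q} \<le> 1"
      using card_nonorigins_one_twin[OF p(2-4), of S] p(1) by simp
  qed
  show "\<forall>S\<in>T2. card {q\<in>S. \<not> principal_origin q} \<le> 2"
  proof
    fix S assume "S \<in> T2"
    then obtain p where p: "S = {p, p + 2, p + 6}" "p > 5" "prime p" "prime (p + 2)"
      unfolding T2_def by blast
    \<comment> \<open>Three elements, minus one origin from the twin pair.\<close>
    show "card {q\<in>S. \<not> principal_origin q} \<le> 2"
      using card_nonorigins_one_twin[OF p(2-4), of S] p(1) by simp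
  qed
  show "\<forall>S\<in>T3. card {q\<in>S. \<not> principal_origin q} \<le> 2"
  proof
    fix S assume "S \<in> T3"
    then obtain p where p: "S = {p, p + 2, p + 6, p + 8}" "p > 5" "prime p" "prime (p + 2)"
        "prime (p + 6)" "prime (p + 8)"
      unfolding T3_def by blast
    show "card {q\<in>S. \<not> principal_origin q} \<le> 2"
      using card_nonorigins_two_twins[OF p(2-6), of S] p(1) by simp
  qed
  show "\<forall>S\<in>T4. card {q\<in>S. \<not> principal_origin q} \<le> 3"
  proof
    fix S assume "S \<in> T4"
    then obtain p where p: "S = {p, p + 2, p + 6, p + 8, p + 12}" "p > 5" "prime p"
        "prime (p + 2)" "prime (p + 6)" "prime (p + 8)"
      unfolding T4_def by blast
    \<comment> \<open>Five elements, minus one origin from each of the two twin pairs;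
      \<open>p + 12\<close> may be a non-origin.\<close>
    show "card {q\<in>S. \<not> principal_origin q} \<le> 3"
      using card_nonorigins_two_twins[OF p(2-6), of S] p(1) by simp
  qed
  show "\<forall>S \<in> T1 \<union> T2 \<union> T3 \<union> T4. \<forall>q\<in>S. principal_origin q \<longleftrightarrow> q \<in> P1"
    using principal_origin_iff_P1 by blast
qed

end
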